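(* Let $f\in\mathcal{R}_1$ have the power series expansion $f(z)=z+a_2z^2+a_3z^3+\cdots$ in $\mathbb{D}$. Then \[ |H_3(1)| \le \frac{3537}{129600}, \] where $H_3(1)=a_3(a_2a_4-a_3^2)-a_4(a_4-a_2a_3)+a_5(a_3-a_2^2)$.
   Context: Let $\mathbb{D}=\{z\in\mathbb{C}: |z|<1\}$ be the open unit disk. Let $\mathcal{A}$ be the class of functions $f$ analytic in $\mathbb{D}$ of the form $f(z)=z+a_2z^2+a_3z^3+\cdots$. The class $\mathcal{R}_1\subset\mathcal{A}$ consists of the functions $f\in\mathcal{A}$ satisfying $\operatorname{Re}\{f'(z)+zf''(z)\}>0$ for all $z\in\mathbb{D}$. The third Hankel determinant of $f\in\mathcal{A}$ is \[ H_3(1)=\begin{vmatrix} 1 & a_2 & a_3\\ a_2 & a_3 & a_4\\ a_3 & a_4 & a_5\end{vmatrix} = a_3(a_2a_4-a_3^2)-a_4(a_4-a_2a_3)+a_5(a_3-a_2^2). \] *)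

theory Defs
  imports "HOL-Analysis.Analysis"
begin

abbreviation unit_disk :: "complex set" where
  "unit_disk \<equiv> ball 0 1"

text \<open>
  \<open>f(z) = z + a\<^sub>2 z\<^sup>2 + a\<^sub>3 z\<^sup>3 + \<dots>\<close> on the unit disk. The values \<open>a 0\<close> and \<open>a 1\<close> are unused:
  the first two coefficients are fixed to 0 and 1 by the shape of the expansion.
\<close>
definition has_expansion :: "(complex \<Rightarrow> complex) \<Rightarrow> (nat \<Rightarrow> complex) \<Rightarrow> bool" where
  "has_expansion f a \<longleftrightarrow>
     (\<forall>z\<in>unit_disk. (\<lambda>n. a (n + 2) * z ^ (n + 2)) sums (f z - z))"

definition class_A :: "(complex \<Rightarrow> complex) set" where
  "class_A = {f. f analytic_on unit_disk \<and> (\<exists>a. has_expansion f a)}"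

definition class_R1 :: "(complex \<Rightarrow> complex) set" where
  "class_R1 = {f \<in> class_A. \<forall>z\<in>unit_disk. Re (deriv f z + z * deriv (deriv f) z) > 0}"

text \<open>The third Hankel determinant \<open>H\<^sub>3(1)\<close>, with \<open>a\<^sub>1 = 1\<close> in the top left entry.\<close>
definition hankel_3_1 :: "(nat \<Rightarrow> complex) \<Rightarrow> complex" where
  "hankel_3_1 a = det (vector [vector [1,   a 2, a 3],
                               vector [a 2, a 3, a 4],
                               vector [a 3, a 4, a 5]] :: complex ^ 3 ^ 3)"

lemma hankel_3_1_expand:
  "hankel_3_1 a =
     a 3 * (a 2 * a 4 - (a 3)\<^sup>2) - a 4 * (a 4 - a 2 * a 3) + a 5 * (a 3 - (a 2)\<^sup>2)"
  unfolding hankel_3_1_def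
  by (simp add: det_3 algebra_simps power2_eq_square)

end

theory Submission
  imports Defs "HOL-Complex_Analysis.Complex_Analysis"
begin

text \<open>
  Write \<open>p(z) = f'(z) + z f''(z) = 1 + c\<^sub>1 z + c\<^sub>2 z\<^sup>2 + \<dots>\<close>. Comparing coefficients gives
  \<open>n\<^sup>2 a\<^sub>n = c\<^bsub>n-1\<^esub>\<close>, and \<open>p\<close> has positive real part, so its Cayley transform
  \<open>w = (p - 1) / (p + 1) = w\<^sub>1 z + w\<^sub>2 z\<^sup>2 + \<dots>\<close> maps the disk into itself. The \<open>c\<^sub>k\<close>, hence also
  the \<open>a\<^sub>k\<close>, are polynomials in the \<open>w\<^sub>k\<close>.

  Two facts then suffice. First, a holomorphic function bounded by 1 has square-summable
  coefficients with sum at most 1 (\<open>bounded_holomorphic_Bessel\<close>), so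
  \<open>\<bar>w\<^sub>1\<bar>\<^sup>2 + \<bar>w\<^sub>2\<bar>\<^sup>2 + \<bar>w\<^sub>3\<bar>\<^sup>2 + \<bar>w\<^sub>4\<bar>\<^sup>2 \<le> 1\<close>. Second, in terms of the \<open>w\<^sub>k\<close> most of the large
  contributions to the Hankel determinant cancel (\<open>hankel_3_1_Schwarz_coeffs\<close>), and what is
  left has such small coefficients that the triangle inequality bounds each monomial by a small
  multiple of \<open>\<bar>w\<^sub>j\<bar>\<^sup>2 + \<bar>w\<^sub>k\<bar>\<^sup>2\<close> for some \<open>j\<close>, \<open>k\<close> (\<open>Hankel_majorant_le\<close>). The total is at most
  \<open>1/50\<close>, which is smaller than \<open>3537/129600\<close>.
\<close>

section \<open>Taylor coefficients of bounded holomorphic functions\<close>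

lemma circle_mean_eq_fps_nth:
  assumes h: "h holomorphic_on ball 0 R" and H: "h has_fps_expansion H"
    and r: "0 < r" "r < R"
  shows "((\<lambda>t. h (circlepath 0 r t) / circlepath 0 r t ^ k) has_integral fps_nth H k) {0..1}"
proof -
  have deriv_circlepath: "vector_derivative (circlepath 0 r) (at t) = 2 * pi * \<i> * circlepath 0 r t" for t
    unfolding vector_derivative_circlepath by (simp add: circlepath)
  have "((\<lambda>u. h u / (u - 0) ^ Suc k) has_contour_integral
          (2 * pi * \<i>) / fact k * (deriv ^^ k) h 0) (circlepath 0 r)"
  proof (rule Cauchy_has_contour_integral_higher_derivative_circlepath)
    show "continuous_on (cball 0 r) h"
      by (rule holomorphic_on_imp_continuous_on, rule holomorphic_on_subset[OF h]) (use r in auto)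
    show "h holomorphic_on ball 0 r"
      by (rule holomorphic_on_subset[OF h]) (use r in auto)
  qed (use r in auto)
  also have "(2 * pi * \<i>) / fact k * (deriv ^^ k) h 0 = 2 * pi * \<i> * fps_nth H k"
    using fps_nth_fps_expansion[OF H, of k] by simp
  finally have "((\<lambda>t. h (circlepath 0 r t) / circlepath 0 r t ^ Suc k * (2 * pi * \<i> * circlepath 0 r t))
          has_integral 2 * pi * \<i> * fps_nth H k) {0..1}"
    unfolding has_contour_integral deriv_circlepath by simp
  then have "((\<lambda>t. 1 / (2 * pi * \<i>) *
            (h (circlepath 0 r t) / circlepath 0 r t ^ Suc k * (2 * pi * \<i> * circlepath 0 r t)))
          has_integral 1 / (2 * pi * \<i>) * (2 * pi * \<i> * fps_nth H k)) {0..1}"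
    by (rule has_integral_mult_right)
  moreover have "circlepath 0 r t \<noteq> 0" for t
    using r by (simp add: circlepath)
  ultimately show ?thesis
    by (simp add: field_simps)
qed

text \<open>
  If \<open>q\<close> is the Taylor polynomial of \<open>g\<close>, then on each circle \<open>\<bar>z\<bar> = r\<close> the means of
  \<open>cnj q \<sqdot> g\<close> and of \<open>cnj q \<sqdot> q\<close> both equal \<open>S = \<Sum> \<bar>g\<^sub>k\<bar>\<^sup>2 r\<^bsup>2k\<^esup>\<close>. Pointwise
  \<open>2 Re (cnj q \<sqdot> g) - \<bar>q\<bar>\<^sup>2 \<le> \<bar>g\<bar>\<^sup>2 \<le> 1\<close>, and taking means gives \<open>S \<le> 1\<close>. The radius is kept
  below 1 because \<open>g\<close> need not extend to the boundary.
\<close>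
lemma bounded_holomorphic_Bessel:
  assumes g: "g holomorphic_on ball 0 1" and G: "g has_fps_expansion G"
    and le1: "\<And>z. z \<in> ball 0 1 \<Longrightarrow> norm (g z) \<le> 1"
  shows "(\<Sum>k\<le>n. (norm (fps_nth G k))\<^sup>2) \<le> 1"
proof -
  define q where "q z = (\<Sum>k\<le>n. fps_nth G k * z ^ k)" for z
  have q: "q holomorphic_on ball 0 1"
    unfolding q_def by (intro holomorphic_intros)
  define Q where "Q = Abs_fps (\<lambda>k. if k \<le> n then fps_nth G k else 0)"
  have "(\<lambda>k. fps_nth Q k * z ^ k) sums q z" for z
    using sums_finite[of "{..n}" "\<lambda>k. fps_nth Q k * z ^ k"] by (simp add: Q_def q_def)
  then have Q: "q has_fps_expansion Q"
    by (intro has_fps_expansionI) simp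
  have bound: "(\<Sum>k\<le>n. (norm (fps_nth G k))\<^sup>2 * r ^ (2 * k)) \<le> 1" if r: "0 < r" "r < 1" for r :: real
  proof -
    define S where "S = (\<Sum>k\<le>n. (norm (fps_nth G k))\<^sup>2 * r ^ (2 * k))"
    define c where "c k = cnj (fps_nth G k) * r ^ (2 * k)" for k
    let ?\<gamma> = "circlepath 0 r"
    have norm\<gamma>: "norm (?\<gamma> t) = r" for t
      using r by (simp add: circlepath norm_mult)
    \<comment> \<open>On the circle \<open>cnj z = r\<^sup>2 / z\<close>, so multiplying by \<open>cnj q\<close> before taking the mean
      extracts a combination of Taylor coefficients.\<close>
    have cnj_q: "(\<Sum>k\<le>n. c k * (y / ?\<gamma> t ^ k)) = cnj (q (?\<gamma> t)) * y" for t y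
    proof -
      have nz: "?\<gamma> t \<noteq> 0"
        using norm\<gamma>[of t] r by auto
      have "complex_of_real (r ^ (2 * k)) = ?\<gamma> t ^ k * cnj (?\<gamma> t) ^ k" for k
        using arg_cong[OF complex_norm_square[of "?\<gamma> t"], of "\<lambda>x. x ^ k"]
        by (simp add: norm\<gamma> power_mult power_mult_distrib)
      then have "c k * (y / ?\<gamma> t ^ k) = cnj (fps_nth G k) * cnj (?\<gamma> t) ^ k * y" for k
        using nz by (simp add: c_def)
      then show ?thesis
        by (simp add: q_def sum_distrib_right)
    qed
    have mean: "((\<lambda>t. cnj (q (?\<gamma> t)) * h (?\<gamma> t)) has_integral S) {0..1}"
      if h: "h holomorphic_on ball 0 1" "h has_fps_expansion H"
        and eq: "\<And>k. k \<le> n \<Longrightarrow> fps_nth H k = fps_nth G k" for h H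
    proof -
      have "((\<lambda>t. \<Sum>k\<le>n. c k * (h (?\<gamma> t) / ?\<gamma> t ^ k)) has_integral (\<Sum>k\<le>n. c k * fps_nth H k)) {0..1}"
        by (intro has_integral_sum has_integral_mult_right circle_mean_eq_fps_nth[OF h]) (use r in auto)
      moreover have "(\<Sum>k\<le>n. c k * fps_nth H k) = S"
        unfolding S_def of_real_sum
      proof (intro sum.cong refl)
        fix k assume "k \<in> {..n}"
        then have "c k * fps_nth H k = fps_nth G k * cnj (fps_nth G k) * complex_of_real (r ^ (2 * k))"
          by (simp add: c_def eq)
        then show "c k * fps_nth H k = complex_of_real ((norm (fps_nth G k))\<^sup>2 * r ^ (2 * k))"
          by (simp only: complex_norm_square of_real_mult)
      qed
      ultimately show ?thesis
        by (simp only: cnj_q)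
    qed
    let ?F = "\<lambda>t. 2 * (cnj (q (?\<gamma> t)) * g (?\<gamma> t)) - cnj (q (?\<gamma> t)) * q (?\<gamma> t)"
    have "(?F has_integral 2 * complex_of_real S - complex_of_real S) {0..1}"
      by (intro has_integral_diff has_integral_mult_right mean[OF g G] mean[OF q Q]) (auto simp: Q_def)
    from has_integral_linear[OF this bounded_linear_Re]
    have "((\<lambda>t. Re (?F t)) has_integral Re (2 * complex_of_real S - complex_of_real S)) {0..1}"
      by (simp only: o_def)
    moreover have "Re (2 * complex_of_real S - complex_of_real S) = S"
      by simp
    ultimately have ReF: "((\<lambda>t. Re (?F t)) has_integral S) {0..1}"
      by (simp only:)
    have "Re (?F t) \<le> 1" for t
    proof -
      let ?x = "q (?\<gamma> t)" and ?y = "g (?\<gamma> t)"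
      have "Re (2 * (cnj ?x * ?y) - cnj ?x * ?x) = (norm ?y)\<^sup>2 - (norm (?y - ?x))\<^sup>2"
        by (simp add: cmod_power2) (simp add: power2_eq_square algebra_simps)
      also have "\<dots> \<le> (norm ?y)\<^sup>2"
        by simp
      also have "\<dots> \<le> 1"
        using le1[of "?\<gamma> t"] r by (simp add: norm\<gamma> abs_square_le_1)
      finally show ?thesis .
    qed
    then show ?thesis
      using has_integral_le[OF ReF has_integral_const_real[of 1 0 1]] by (simp add: S_def)
  qed
  have "((\<lambda>r::real. \<Sum>k\<le>n. (norm (fps_nth G k))\<^sup>2 * r ^ (2 * k)) \<longlongrightarrow>
           (\<Sum>k\<le>n. (norm (fps_nth G k))\<^sup>2 * 1 ^ (2 * k))) (at_left 1)"
    by (intro tendsto_intros)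
  moreover have "\<forall>\<^sub>F r::real in at_left 1. (\<Sum>k\<le>n. (norm (fps_nth G k))\<^sup>2 * r ^ (2 * k)) \<le> 1"
    using eventually_at_left_real[OF zero_less_one] by (rule eventually_mono) (simp add: bound)
  ultimately show ?thesis
    using tendsto_upperbound[of _ _ "at_left (1::real)" 1] by simp
qed

section \<open>Functions with positive real part and their Schwarz functions\<close>

text \<open>
  The series \<open>W\<close> belongs to the Cayley transform \<open>(p - 1) / (p + 1)\<close>, which is bounded by 1 because a
  point of the right half-plane is closer to 1 than to -1. The equation with the denominator
  cleared lets the coefficients of \<open>P\<close> be computed recursively from those of \<open>W\<close>.
\<close>
lemma Caratheodory_Schwarz_series:
  assumes p: "p holomorphic_on ball 0 1" and P: "p has_fps_expansion P"
    and pos: "\<And>z. z \<in> ball 0 1 \<Longrightarrow> Re (p z) > 0"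
  obtains W where "W * (P + 1) = P - 1" "\<And>n. (\<Sum>k\<le>n. (norm (fps_nth W k))\<^sup>2) \<le> 1"
proof -
  define w where "w z = (p z - 1) / (p z + 1)" for z
  have nz: "p z + 1 \<noteq> 0" if "z \<in> ball 0 1" for z
  proof
    assume "p z + 1 = 0"
    from arg_cong[OF this, of Re] show False
      using pos[OF that] by simp
  qed
  have w: "w holomorphic_on ball 0 1"
    unfolding w_def by (intro holomorphic_intros p) (use nz in auto)
  define W where "W = fps_expansion w 0"
  have W: "w has_fps_expansion W"
    unfolding W_def by (rule has_fps_expansion_fps_expansion[OF _ _ w]) auto
  have "norm (w z) \<le> 1" if z: "z \<in> ball 0 1" for z
  proof -
    have "(norm (p z - 1))\<^sup>2 \<le> (norm (p z + 1))\<^sup>2"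
      using pos[OF z] by (simp add: cmod_power2) (simp add: power2_eq_square algebra_simps)
    then have "norm (p z - 1) \<le> norm (p z + 1)"
      by (rule power2_le_imp_le) simp
    then show ?thesis
      using nz[OF z] by (simp add: w_def norm_divide)
  qed
  then have "(\<Sum>k\<le>n. (norm (fps_nth W k))\<^sup>2) \<le> 1" for n
    by (intro bounded_holomorphic_Bessel[OF w W])
  moreover have "W * (P + 1) = P - 1"
  proof (rule fps_expansion_unique_complex)
    show "(\<lambda>z. w z * (p z + 1)) has_fps_expansion W * (P + 1)"
      by (intro fps_expansion_intros W P)
    have "\<forall>\<^sub>F z in nhds 0. p z - 1 = w z * (p z + 1)"
    proof (rule eventually_mono)
      show "\<forall>\<^sub>F z in nhds (0::complex). z \<in> ball 0 1"
        by (intro eventually_nhds_in_open) auto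
    qed (use nz in \<open>simp add: w_def\<close>)
    moreover have "(\<lambda>z. p z - 1) has_fps_expansion P - 1"
      by (intro fps_expansion_intros P)
    ultimately show "(\<lambda>z. w z * (p z + 1)) has_fps_expansion P - 1"
      by (rule iffD1[OF has_fps_expansion_cong[OF _ refl]])
  qed
  ultimately show ?thesis
    by (rule that[rotated])
qed

lemma Caratheodory_coeffs_of_Schwarz_coeffs:
  fixes W P :: "complex fps"
  assumes WP: "W * (P + 1) = P - 1" and P0: "fps_nth P 0 = 1"
  defines "w \<equiv> fps_nth W"
  shows "fps_nth P 1 = 2 * w 1"
    and "fps_nth P 2 = 2 * (w 2 + w 1 ^ 2)"
    and "fps_nth P 3 = 2 * (w 3 + 2 * w 1 * w 2 + w 1 ^ 3)"
    and "fps_nth P 4 = 2 * (w 4 + 2 * w 1 * w 3 + w 2 ^ 2 + 3 * w 1 ^ 2 * w 2 + w 1 ^ 4)"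
proof -
  have nth: "fps_nth (W * (P + 1)) n = fps_nth (P - 1) n" for n
    by (simp add: WP)
  have w0: "w 0 = 0"
    using nth[of 0] by (simp add: P0 w_def)
  show 1: "fps_nth P 1 = 2 * w 1"
    using nth[of 1] w0 by (simp add: fps_mult_nth P0 w_def mult.commute)
  show 2: "fps_nth P 2 = 2 * (w 2 + w 1 ^ 2)"
    using nth[of 2] w0 1 by (simp add: fps_mult_nth P0 w_def eval_nat_numeral algebra_simps)
  show 3: "fps_nth P 3 = 2 * (w 3 + 2 * w 1 * w 2 + w 1 ^ 3)"
    using nth[of 3] w0 1 2 by (simp add: fps_mult_nth P0 w_def eval_nat_numeral algebra_simps)
  show "fps_nth P 4 = 2 * (w 4 + 2 * w 1 * w 3 + w 2 ^ 2 + 3 * w 1 ^ 2 * w 2 + w 1 ^ 4)"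
    using nth[of 4] w0 1 2 3 by (simp add: fps_mult_nth P0 w_def eval_nat_numeral algebra_simps)
qed

lemma class_R1_Caratheodory_series:
  assumes f: "f \<in> class_R1" and a: "has_expansion f a"
  obtains p P where "p holomorphic_on ball 0 1" "p has_fps_expansion P"
    "\<And>z. z \<in> ball 0 1 \<Longrightarrow> Re (p z) > 0"
    "fps_nth P 0 = 1" "\<And>n. n \<ge> 1 \<Longrightarrow> fps_nth P n = of_nat (Suc n) ^ 2 * a (Suc n)"
proof -
  define F where "F = Abs_fps (\<lambda>n. if n = 0 then 0 else if n = 1 then 1 else a n)"
  have hol: "f holomorphic_on ball 0 1"
    using f by (simp add: class_R1_def class_A_def analytic_imp_holomorphic)
  have "(\<lambda>n. fps_nth F n * z ^ n) sums f z" if "z \<in> ball 0 1" for z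
  proof -
    have "(\<lambda>n. fps_nth F (n + 2) * z ^ (n + 2)) sums (f z - z)"
      using a that by (simp add: has_expansion_def F_def)
    then show ?thesis
      by (subst (asm) sums_iff_shift) (simp add: F_def eval_nat_numeral)
  qed
  then have F: "f has_fps_expansion F"
    using eventually_nhds_in_open[of "ball 0 1" "0::complex"]
    by (intro has_fps_expansionI) (auto elim!: eventually_mono)
  show ?thesis
  proof
    show "(\<lambda>z. deriv f z + z * deriv (deriv f) z) holomorphic_on ball 0 1"
      by (intro holomorphic_intros holomorphic_deriv hol) auto
    show "(\<lambda>z. deriv f z + z * deriv (deriv f) z) has_fps_expansion
        fps_deriv F + fps_X * fps_deriv (fps_deriv F)"
      by (intro fps_expansion_intros F)
    show "Re (deriv f z + z * deriv (deriv f) z) > 0" if "z \<in> ball 0 1" for z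
      using f that by (simp add: class_R1_def)
    show "fps_nth (fps_deriv F + fps_X * fps_deriv (fps_deriv F)) 0 = 1"
      by (simp add: F_def)
    show "fps_nth (fps_deriv F + fps_X * fps_deriv (fps_deriv F)) n = of_nat (Suc n) ^ 2 * a (Suc n)"
      if "n \<ge> 1" for n
      using that by (cases n) (auto simp: F_def power2_eq_square algebra_simps)
  qed
qed

section \<open>The Hankel determinant in Schwarz coefficients\<close>

text \<open>
  The parameters \<open>u, v, s, t\<close> are the first four Schwarz coefficients. The gain over estimating
  the products \<open>a\<^sub>i a\<^sub>j a\<^sub>k\<close> separately comes from cancellation: for example, the coefficient of
  \<open>u v s\<close> collects \<open>1/36 - 1/16 + 8/225 = 1/1200\<close>.
\<close>
lemma hankel_3_1_Schwarz_coeffs: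
  fixes u v s t :: complex
  assumes "a 2 = u / 2"
    and "a 3 = 2 * (v + u ^ 2) / 9"
    and "a 4 = (s + 2 * u * v + u ^ 3) / 8"
    and "a 5 = 2 * (t + 2 * u * s + v ^ 2 + 3 * u ^ 2 * v + u ^ 4) / 25"
  shows "hankel_3_1 a =
    - (s ^ 2 / 64) + 4 * (v * t) / 225 - u ^ 2 * t / 450 + u * v * s / 1200 - 19 * (u ^ 3 * s) / 2400
    + 124 * v ^ 3 / 18225 + 1093 * (u ^ 2 * v ^ 2) / 97200 - 19 * (u ^ 4 * v) / 19440
    - 1217 * u ^ 6 / 1166400"
  unfolding hankel_3_1_expand assms by (simp add: field_simps) algebra

text \<open>
  Since all variables lie between 0 and 1, every monomial is at most a square or a product of two
  variables, and the products are split evenly by the arithmetic-geometric mean inequality. In the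
  resulting diagonal quadratic form the largest coefficient is the one of \<open>z\<^sup>2\<close>, namely
  \<open>1/64 + 1/2400 + 19/4800 = 1/50\<close>.
\<close>
lemma Hankel_majorant_le:
  fixes x y z t :: real
  assumes nonneg: "x \<ge> 0" "y \<ge> 0" "z \<ge> 0" "t \<ge> 0" and sum: "x\<^sup>2 + y\<^sup>2 + z\<^sup>2 + t\<^sup>2 \<le> 1"
  shows "z ^ 2 / 64 + 4 * (y * t) / 225 + x ^ 2 * t / 450 + x * y * z / 1200 + 19 * (x ^ 3 * z) / 2400
    + 124 * y ^ 3 / 18225 + 1093 * (x ^ 2 * y ^ 2) / 97200 + 19 * (x ^ 4 * y) / 19440
    + 1217 * x ^ 6 / 1166400 \<le> 1 / 50"
proof -
  have "x\<^sup>2 \<le> 1" "y\<^sup>2 \<le> 1"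
    using sum zero_le_power2[of x] zero_le_power2[of y] zero_le_power2[of z] zero_le_power2[of t] by linarith+
  then have x1: "x \<le> 1" and y1: "y \<le> 1"
    by (simp_all add: power_le_one_iff nonneg)
  have AM_GM: "2 * (b * c) \<le> b\<^sup>2 + c\<^sup>2" for b c :: real
    using sum_squares_bound[of b c] by (simp add: mult.assoc)
  have "x ^ 2 * t \<le> x * t"
    using x1 nonneg by (simp add: power2_eq_square mult_left_le_one_le mult_right_mono)
  moreover have "x * y * z \<le> y * z"
    using x1 nonneg by (simp add: mult_left_le_one_le mult_right_mono)
  moreover have "x ^ 3 * z \<le> x * z"
    using x1 nonneg power_decreasing[of 1 3 x] by (simp add: mult_right_mono)
  moreover have "y ^ 3 \<le> y ^ 2"
    using y1 nonneg by (intro power_decreasing) auto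
  moreover have "x ^ 2 * y ^ 2 \<le> x ^ 2"
    using y1 nonneg by (simp add: mult_left_le power_le_one)
  moreover have "x ^ 4 * y \<le> x ^ 2"
    using mult_mono[of "x ^ 4" "x ^ 2" y 1] x1 y1 nonneg power_decreasing[of 2 4 x] by simp
  moreover have "x ^ 6 \<le> x ^ 2"
    using x1 nonneg by (intro power_decreasing) auto
  ultimately show ?thesis
    using AM_GM[of y t] AM_GM[of x t] AM_GM[of y z] AM_GM[of x z] sum
      zero_le_power2[of x] zero_le_power2[of y] zero_le_power2[of z] zero_le_power2[of t]
    by linarith
qed

theorem theorem2:
  fixes f :: "complex \<Rightarrow> complex" and a :: "nat \<Rightarrow> complex"
  assumes "f \<in> class_R1"
    and "has_expansion f a"
  shows "norm (hankel_3_1 a) \<le> 3537 / 129600"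
proof -
  obtain p P where p: "p holomorphic_on ball 0 1" "p has_fps_expansion P"
      "\<And>z. z \<in> ball 0 1 \<Longrightarrow> Re (p z) > 0"
    and P0: "fps_nth P 0 = 1"
    and P: "\<And>n. n \<ge> 1 \<Longrightarrow> fps_nth P n = of_nat (Suc n) ^ 2 * a (Suc n)"
    using class_R1_Caratheodory_series[OF assms] by metis
  obtain W where W: "W * (P + 1) = P - 1" and W_sum: "\<And>n. (\<Sum>k\<le>n. (norm (fps_nth W k))\<^sup>2) \<le> 1"
    using Caratheodory_Schwarz_series[OF p] by metis
  define u v s t where uvst: "u = fps_nth W 1" "v = fps_nth W 2" "s = fps_nth W 3" "t = fps_nth W 4"
  note c = Caratheodory_coeffs_of_Schwarz_coeffs[OF W P0, folded uvst]
  have "4 * a 2 = 2 * u" "9 * a 3 = 2 * (v + u ^ 2)" "2 * (8 * a 4) = 2 * (s + 2 * u * v + u ^ 3)"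
      "25 * a 5 = 2 * (t + 2 * u * s + v ^ 2 + 3 * u ^ 2 * v + u ^ 4)"
    using c P[of 1] P[of 2] P[of 3] P[of 4] by (simp_all add: eval_nat_numeral)
  moreover from this(3) have "8 * a 4 = s + 2 * u * v + u ^ 3"
    by (simp only: mult_cancel_left) simp
  ultimately have "a 2 = u / 2" "a 3 = 2 * (v + u ^ 2) / 9" "a 4 = (s + 2 * u * v + u ^ 3) / 8"
      "a 5 = 2 * (t + 2 * u * s + v ^ 2 + 3 * u ^ 2 * v + u ^ 4) / 25"
    by (simp_all add: field_simps)
  then have H: "hankel_3_1 a =
    - (s ^ 2 / 64) + 4 * (v * t) / 225 - u ^ 2 * t / 450 + u * v * s / 1200 - 19 * (u ^ 3 * s) / 2400
    + 124 * v ^ 3 / 18225 + 1093 * (u ^ 2 * v ^ 2) / 97200 - 19 * (u ^ 4 * v) / 19440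
    - 1217 * u ^ 6 / 1166400"
    by (rule hankel_3_1_Schwarz_coeffs)
  have "norm (hankel_3_1 a) \<le>
    norm (- (s ^ 2 / 64)) + norm (4 * (v * t) / 225) + norm (u ^ 2 * t / 450) + norm (u * v * s / 1200)
    + norm (19 * (u ^ 3 * s) / 2400) + norm (124 * v ^ 3 / 18225) + norm (1093 * (u ^ 2 * v ^ 2) / 97200)
    + norm (19 * (u ^ 4 * v) / 19440) + norm (1217 * u ^ 6 / 1166400)"
    unfolding H by (intro norm_triangle_le norm_triangle_le_diff add_mono order.refl)
  also have "\<dots> \<le> 1 / 50"
  proof -
    have "(norm u)\<^sup>2 + (norm v)\<^sup>2 + (norm s)\<^sup>2 + (norm t)\<^sup>2 \<le> (\<Sum>k\<le>4. (norm (fps_nth W k))\<^sup>2)"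
      by (simp add: uvst eval_nat_numeral)
    also have "\<dots> \<le> 1"
      by (rule W_sum)
    finally show ?thesis
      using Hankel_majorant_le[of "norm u" "norm v" "norm s" "norm t"]
      by (simp add: norm_mult norm_divide norm_power)
  qed
  finally show ?thesis
    by simp
qed

end
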